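(* Let $0<p<1$ and let $\rho$ be a probability distribution on $\mathbb{R}_+=[0,+\infty)$ such that $\int_0^{+\infty}\log(1+bf)\,\rho(b)\,db<+\infty$ for every $f\in[0,1)$. Consider the game with win probability $p$ and variable pay-off distributed according to $\rho$. If $$p\left(1+\int_0^{+\infty} b\,\rho(b)\,db\right)>1,$$ then the game is favorable. Moreover, under this condition, the expected value of the exponential rate of growth $$g(f)=\mathbb{E}(G_n)=(1-p)\log(1-f)+p\int_0^{+\infty}\log(1+bf)\,\rho(b)\,db$$ is maximized, over betting fractions $f\in[0,1]$, at $f=\hat f$ with $\hat f=\hat f(p,\rho)$, $0<\hat f<1$, satisfying $$p\int_0^{+\infty}\frac{b\,\rho(b)}{1+b\hat f}\,db-\frac{1-p}{1-\hat f}=0.$$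
   Context: A game is played repeatedly. At each round the player bets a fixed fraction $f\in[0,1]$ of the current capital $X$. With probability $1-p$ the bet is lost and the capital becomes $(1-f)X$. With probability $p$ the bet is won and the capital becomes $(1+bf)X$, where the pay-off $b\ge 0$ (that is, $b$-to-$1$) is a random variable with distribution $\rho$. The distribution $\rho$ need not be absolutely continuous: $\rho(b)\,db$ denotes integration against the probability distribution $\rho$. Let $X_0>0$ be the initial capital and $X_n$ the capital after $n\ge1$ rounds. The game is called favorable if the expected gain of a round is positive, i.e. $\mathbb{E}(X_1-X_0)>0$ when betting a fraction $f>0$. The exponential rate of growth is $G_n=\frac1n\log\frac{X_n}{X_0}$. Its expectation does not depend on $n$ and equals the function $g(f)$ given in the claim, with the convention $g(1)=-\infty$. *)

theory Defs
  imports "HOL-Probability.Probability"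
begin

(* Natural logarithm with values in [-\<infinity>, \<infinity>), so that a ruined player (capital 0) has
   logarithmic growth -\<infinity>.  (The library's ln is a real number, also at 0.) *)
definition elog :: "real \<Rightarrow> ereal" where
  "elog x = (if 0 < x then ereal (ln x) else - \<infinity>)"

(* The expectation of X exists in [-\<infinity>, \<infinity>] and equals e: at least one of the expectations of
   the positive and negative parts of X is finite, and e is their difference.  The finiteness
   clause excludes the meaningless case \<infinity> - \<infinity>. *)
definition has_expectation :: "'a measure \<Rightarrow> ('a \<Rightarrow> ereal) \<Rightarrow> ereal \<Rightarrow> bool" where
  "has_expectation M X e \<longleftrightarrow>
     X \<in> borel_measurable M \<and>
     ((\<integral>\<^sup>+\<omega>. e2ennreal (X \<omega>) \<partial>M) < \<infinity> \<or> (\<integral>\<^sup>+\<omega>. e2ennreal (- X \<omega>) \<partial>M) < \<infinity>) \<and>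
     e = enn2ereal (\<integral>\<^sup>+\<omega>. e2ennreal (X \<omega>) \<partial>M) - enn2ereal (\<integral>\<^sup>+\<omega>. e2ennreal (- X \<omega>) \<partial>M)"

(* W k is the event that the bet of round k (counted from 0) is won and B k its pay-off.  The
   rounds are independent; in each of them the bet is won with probability p and, given that it
   is won, the pay-off has distribution \<rho>.  The value of B k in a lost round is never used, and
   nothing is assumed about its conditional distribution there. *)
locale betting_game = prob_space M
  for M :: "'a measure" and p :: real and \<rho> :: "real measure"
    and W :: "nat \<Rightarrow> 'a \<Rightarrow> bool" and B :: "nat \<Rightarrow> 'a \<Rightarrow> real" +
  assumes indep_rounds:
      "indep_vars (\<lambda>_. count_space UNIV \<Otimes>\<^sub>M borel) (\<lambda>k \<omega>. (W k \<omega>, B k \<omega>)) UNIV"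
    and win_law:
      "\<And>k A. A \<in> sets borel \<Longrightarrow>
         prob {\<omega> \<in> space M. W k \<omega> \<and> B k \<omega> \<in> A} = p * measure \<rho> A"

primrec capital ::
  "(nat \<Rightarrow> 'a \<Rightarrow> bool) \<Rightarrow> (nat \<Rightarrow> 'a \<Rightarrow> real) \<Rightarrow> real \<Rightarrow> real \<Rightarrow> nat \<Rightarrow> 'a \<Rightarrow> real" where
  "capital W B f x0 0 \<omega> = x0"
| "capital W B f x0 (Suc n) \<omega> =
     (if W n \<omega> then 1 + B n \<omega> * f else 1 - f) * capital W B f x0 n \<omega>"

(* The expected gain may be +\<infinity>, since \<rho> need not have a finite mean. *)
definition favorable ::
  "'a measure \<Rightarrow> (nat \<Rightarrow> 'a \<Rightarrow> bool) \<Rightarrow> (nat \<Rightarrow> 'a \<Rightarrow> real) \<Rightarrow> bool" where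
  "favorable M W B \<longleftrightarrow>
     (\<forall>x0>0. \<forall>f. 0 < f \<and> f \<le> 1 \<longrightarrow>
       (\<exists>e>0. has_expectation M
          (\<lambda>\<omega>. ereal (capital W B f x0 1 \<omega> - capital W B f x0 0 \<omega>)) e))"

definition growth_rate ::
  "(nat \<Rightarrow> 'a \<Rightarrow> bool) \<Rightarrow> (nat \<Rightarrow> 'a \<Rightarrow> real) \<Rightarrow> real \<Rightarrow> real \<Rightarrow> nat \<Rightarrow> 'a \<Rightarrow> ereal" where
  "growth_rate W B f x0 n \<omega> =
     ereal (1 / real n) * elog (capital W B f x0 n \<omega> / capital W B f x0 0 \<omega>)"

(* For p < 1 the value at f = 1 is -\<infinity>, because elog 0 = -\<infinity>. *)
definition expected_growth :: "real \<Rightarrow> real measure \<Rightarrow> real \<Rightarrow> ereal" where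
  "expected_growth p \<rho> f =
     ereal (1 - p) * elog (1 - f) + ereal (p * (\<integral>b. ln (1 + b * f) \<partial>\<rho>))"

end

theory Submission
  imports Defs
begin

text \<open>
  The growth statement is linearity of expectation.  As long as every pay-off collected in a won
  round is nonnegative, which holds almost surely, \<open>ln (X\<^sub>n / X\<^sub>0)\<close> is the sum over the rounds of
  \<open>ln (1 + b f)\<close> for a win and \<open>ln (1 - f)\<close> for a loss
  (\<open>ln_capital_ratio\<close>), and a sub-probability change of variables on the event of winning
  (\<open>distr_win\<close>) gives each summand the same expectation \<open>g f\<close>.  The fraction \<open>f = 1\<close> is different:
  a single loss means ruin, so the negative part of the growth rate has infinite expectation, and
  one has to see that the positive part stays integrable
  (\<open>has_expectation_growth_rate_all_in\<close>).  Favorability is the same change of variables applied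
  to the gain of one round, with values in the extended reals because the mean pay-off may be
  infinite.

  For the maximization, let \<open>h f = p \<integral> b / (1 + b f) d\<rho> - (1 - p) / (1 - f)\<close>, which is formally
  the derivative of \<open>g\<close>.  The integrand is at most \<open>1 / f\<close>, so \<open>h\<close> is continuous on \<open>(0, 1)\<close> by
  dominated convergence, and \<open>h p \<le> p / p - (1 - p) / (1 - p) = 0\<close>.  As \<open>f\<close> tends to \<open>0\<close>,
  Fatou's lemma bounds the lower limit of \<open>h f\<close> from below by
  \<open>p \<integral> b d\<rho> - (1 - p)\<close>, which is positive precisely by the assumption on the mean.
  The intermediate value theorem yields a zero of \<open>h\<close> in \<open>(0, p]\<close>
  (\<open>ex_stationary_fraction\<close>).  That such a zero maximizes \<open>g\<close> follows without differentiating
  under the integral sign: \<open>ln x - ln y \<le> (x - y) / y\<close> is the tangent line inequality for the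
  logarithm, and integrating it gives \<open>g f - g s \<le> (f - s) h s = 0\<close>
  (\<open>expected_growth_le_stationary\<close>).
\<close>

section \<open>Extended expectations\<close>

lemma has_expectation_AE_integrable:
  fixes Y :: "'a \<Rightarrow> real"
  assumes X: "X \<in> borel_measurable M" and Y: "integrable M Y"
    and eq: "AE \<omega> in M. X \<omega> = ereal (Y \<omega>)"
  shows "has_expectation M X (ereal (\<integral>\<omega>. Y \<omega> \<partial>M))"
proof -
  have pos: "(\<integral>\<^sup>+\<omega>. e2ennreal (X \<omega>) \<partial>M) = (\<integral>\<^sup>+\<omega>. ennreal (Y \<omega>) \<partial>M)"
    using eq by (intro nn_integral_cong_AE) (auto elim!: eventually_mono)
  have neg: "(\<integral>\<^sup>+\<omega>. e2ennreal (- X \<omega>) \<partial>M) = (\<integral>\<^sup>+\<omega>. ennreal (- Y \<omega>) \<partial>M)"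
    using eq by (intro nn_integral_cong_AE) (auto elim!: eventually_mono)
  from Y obtain r q where rq: "0 \<le> r" "0 \<le> q"
      "(\<integral>\<^sup>+\<omega>. ennreal (Y \<omega>) \<partial>M) = ennreal r" "(\<integral>\<^sup>+\<omega>. ennreal (- Y \<omega>) \<partial>M) = ennreal q"
      "(\<integral>\<omega>. Y \<omega> \<partial>M) = r - q"
    by (rule integrableE)
  show ?thesis
    unfolding has_expectation_def pos neg using X rq by (simp add: enn2ereal_ennreal)
qed

lemma elog_measurable [measurable]: "elog \<in> borel_measurable borel"
  unfolding elog_def[abs_def] by measurable

lemma elog_le_of_le_exp: "x \<le> exp s \<Longrightarrow> elog x \<le> ereal s"
  using ln_mono[of x "exp s"] by (auto simp: elog_def)

section \<open>The capital along a single run of the game\<close>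

text \<open>
  For \<open>f < 1\<close> every round multiplies the capital by a positive factor, so ruin is impossible and
  the logarithm turns the product of the factors into a sum.
\<close>

lemma ln_capital_ratio:
  assumes "0 < x0" "0 \<le> f" "f < 1" and "\<And>k. W k \<omega> \<Longrightarrow> 0 \<le> B k \<omega>"
  shows "0 < capital W B f x0 n \<omega> \<and>
    ln (capital W B f x0 n \<omega> / x0) = (\<Sum>k<n. if W k \<omega> then ln (1 + B k \<omega> * f) else ln (1 - f))"
proof (induction n)
  case 0
  show ?case using assms(1) by simp
next
  case (Suc n)
  let ?c = "if W n \<omega> then 1 + B n \<omega> * f else 1 - f"
  have c: "0 < ?c" using assms by (auto intro: add_pos_nonneg)
  have "ln (?c * (capital W B f x0 n \<omega> / x0)) = ln ?c + ln (capital W B f x0 n \<omega> / x0)"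
    using c Suc.IH assms(1) by (intro ln_mult_pos) simp_all
  then show ?case using c Suc.IH by (auto simp: add.commute)
qed

text \<open>
  At \<open>f = 1\<close> a lost round leaves nothing, so replacing its factor \<open>0\<close> by \<open>1\<close> only increases the
  product.  The resulting upper bound has an integrable logarithm, which controls the positive part
  of the growth rate even though the growth rate itself takes the value \<open>-\<infinity>\<close>.
\<close>

lemma all_in_capital_le:
  assumes "0 < x0" and "\<And>k. W k \<omega> \<Longrightarrow> 0 \<le> B k \<omega>"
  shows "0 \<le> capital W B 1 x0 n \<omega> \<and>
    capital W B 1 x0 n \<omega> / x0 \<le> exp (\<Sum>k<n. if W k \<omega> then ln (1 + B k \<omega>) else 0)"
proof (induction n)
  case 0
  show ?case using assms(1) by simp
next
  case (Suc n)
  show ?case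
  proof (cases "W n \<omega>")
    case True
    then have "0 < 1 + B n \<omega>" using assms(2)[of n] by simp
    then have "(1 + B n \<omega>) * (capital W B 1 x0 n \<omega> / x0)
        \<le> (1 + B n \<omega>) * exp (\<Sum>k<n. if W k \<omega> then ln (1 + B k \<omega>) else 0)"
      using Suc.IH by (intro mult_left_mono) auto
    then show ?thesis using Suc.IH True \<open>0 < 1 + B n \<omega>\<close> by (simp add: exp_add mult.commute)
  next
    case False
    then show ?thesis by simp
  qed
qed

lemma all_in_capital_lost:
  assumes "\<not> W 0 \<omega>" "1 \<le> n"
  shows "capital W B 1 x0 n \<omega> = 0"
  using assms(2) by (induction n rule: dec_induct) (use assms(1) in auto)

section \<open>The law of a round\<close>

context betting_game
begin

lemma W_measurable [measurable]: "Measurable.pred M (W k)"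
  and B_measurable [measurable]: "B k \<in> borel_measurable M"
proof -
  have "(\<lambda>\<omega>. (W k \<omega>, B k \<omega>)) \<in> M \<rightarrow>\<^sub>M count_space UNIV \<Otimes>\<^sub>M borel"
    using indep_rounds by (auto simp: indep_vars_def)
  from measurable_compose[OF this measurable_fst] measurable_compose[OF this measurable_snd]
  show "Measurable.pred M (W k)" "B k \<in> borel_measurable M" by simp_all
qed

lemma capital_measurable [measurable]: "capital W B f x0 n \<in> borel_measurable M"
proof (induction n)
  case 0
  have "capital W B f x0 0 = (\<lambda>_. x0)" by auto
  then show ?case by simp
next
  case (Suc n)
  have [measurable]: "capital W B f x0 n \<in> borel_measurable M" by (rule Suc.IH)
  have "capital W B f x0 (Suc n) =
      (\<lambda>\<omega>. (if W n \<omega> then 1 + B n \<omega> * f else 1 - f) * capital W B f x0 n \<omega>)" by auto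
  then show ?case by simp
qed

lemma growth_rate_measurable [measurable]: "growth_rate W B f x0 n \<in> borel_measurable M"
  unfolding growth_rate_def[abs_def] by measurable

text \<open>
  Restricting the probability measure to the event of winning before taking the image under the
  pay-off encodes the joint law of outcome and pay-off in an equality of measures, from which both
  Lebesgue and Bochner integrals can be transported to \<open>\<rho>\<close>.  Total mass \<open>p\<close> appears as a constant
  density.
\<close>

lemma distr_win:
  assumes "real_distribution \<rho>" "0 \<le> p"
  shows "distr (density M (\<lambda>\<omega>. indicator {\<omega>. W k \<omega>} \<omega>)) borel (B k) = density \<rho> (\<lambda>_. ennreal p)"
proof -
  interpret \<rho>: real_distribution \<rho> by fact
  show ?thesis
  proof (rule measure_eqI)
    fix A assume "A \<in> sets (distr (density M (\<lambda>\<omega>. indicator {\<omega>. W k \<omega>} \<omega>)) borel (B k))"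
    then have [measurable]: "A \<in> sets borel" by simp
    have "emeasure (distr (density M (\<lambda>\<omega>. indicator {\<omega>. W k \<omega>} \<omega>)) borel (B k)) A
        = (\<integral>\<^sup>+\<omega>. indicator {\<omega>. W k \<omega>} \<omega> * indicator (B k -` A \<inter> space M) \<omega> \<partial>M)"
      by (simp add: emeasure_distr emeasure_density)
    also have "\<dots> = (\<integral>\<^sup>+\<omega>. indicator {\<omega> \<in> space M. W k \<omega> \<and> B k \<omega> \<in> A} \<omega> \<partial>M)"
      by (intro nn_integral_cong) (auto simp: indicator_def)
    also have "\<dots> = ennreal p * emeasure \<rho> A"
      using win_law[of A k] assms(2)
      by (simp add: emeasure_eq_measure \<rho>.emeasure_eq_measure ennreal_mult)
    also have "\<dots> = emeasure (density \<rho> (\<lambda>_. ennreal p)) A"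
      by (simp add: emeasure_density nn_integral_cmult_indicator)
    finally show "emeasure (distr (density M (\<lambda>\<omega>. indicator {\<omega>. W k \<omega>} \<omega>)) borel (B k)) A
        = emeasure (density \<rho> (\<lambda>_. ennreal p)) A" .
  qed simp
qed

lemma prob_win:
  assumes "real_distribution \<rho>"
  shows "prob {\<omega> \<in> space M. W k \<omega>} = p"
proof -
  interpret \<rho>: real_distribution \<rho> by fact
  show ?thesis using win_law[of UNIV k] \<rho>.prob_space by simp
qed

lemma prob_loss:
  assumes "real_distribution \<rho>"
  shows "prob {\<omega> \<in> space M. \<not> W k \<omega>} = 1 - p"
proof -
  have "prob {\<omega> \<in> space M. \<not> W k \<omega>} = 1 - prob {\<omega> \<in> space M. W k \<omega>}"
    by (rule prob_neg) simp
  then show ?thesis using prob_win[OF assms] by simp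
qed

lemma nn_integral_win:
  fixes \<phi> :: "real \<Rightarrow> ennreal"
  assumes \<rho>: "real_distribution \<rho>" and p: "0 \<le> p" and [measurable]: "\<phi> \<in> borel_measurable borel"
  shows "(\<integral>\<^sup>+\<omega>. (if W k \<omega> then \<phi> (B k \<omega>) else 0) \<partial>M) = ennreal p * (\<integral>\<^sup>+b. \<phi> b \<partial>\<rho>)"
proof -
  interpret \<rho>: real_distribution \<rho> by fact
  have "(\<integral>\<^sup>+\<omega>. (if W k \<omega> then \<phi> (B k \<omega>) else 0) \<partial>M)
      = (\<integral>\<^sup>+\<omega>. indicator {\<omega>. W k \<omega>} \<omega> * \<phi> (B k \<omega>) \<partial>M)"
    by (intro nn_integral_cong) (auto simp: indicator_def)
  also have "\<dots> = (\<integral>\<^sup>+b. \<phi> b \<partial>distr (density M (\<lambda>\<omega>. indicator {\<omega>. W k \<omega>} \<omega>)) borel (B k))"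
    by (simp add: nn_integral_distr nn_integral_density)
  also have "\<dots> = ennreal p * (\<integral>\<^sup>+b. \<phi> b \<partial>\<rho>)"
    unfolding distr_win[OF \<rho> p] by (simp add: nn_integral_density nn_integral_cmult)
  finally show ?thesis .
qed

lemma expectation_round:
  fixes \<phi> :: "real \<Rightarrow> real"
  assumes \<rho>: "real_distribution \<rho>" and p: "0 \<le> p" and \<phi>: "integrable \<rho> \<phi>"
  shows "integrable M (\<lambda>\<omega>. if W k \<omega> then \<phi> (B k \<omega>) else c)"
    and "expectation (\<lambda>\<omega>. if W k \<omega> then \<phi> (B k \<omega>) else c) = p * (\<integral>b. \<phi> b \<partial>\<rho>) + (1 - p) * c"
proof -
  interpret \<rho>: real_distribution \<rho> by fact
  have [measurable]: "\<phi> \<in> borel_measurable borel" using \<phi> by auto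
  let ?win = "\<lambda>\<omega>. indicator {\<omega>. W k \<omega>} \<omega> :: real"
  let ?N = "density M (\<lambda>\<omega>. ennreal (?win \<omega>))"
  have law: "distr ?N borel (B k) = density \<rho> (\<lambda>_. ennreal p)"
    using distr_win[OF \<rho> p, of k] by (simp add: ennreal_indicator)
  have "integrable (density \<rho> (\<lambda>_. ennreal p)) \<phi>"
    using \<phi> p by (subst integrable_density) auto
  then have "integrable ?N (\<lambda>\<omega>. \<phi> (B k \<omega>))"
    unfolding law[symmetric] by (subst (asm) integrable_distr_eq) auto
  then have win: "integrable M (\<lambda>\<omega>. ?win \<omega> * \<phi> (B k \<omega>))"
    by (subst (asm) integrable_density) auto
  have "(\<integral>\<omega>. ?win \<omega> * \<phi> (B k \<omega>) \<partial>M) = (\<integral>b. \<phi> b \<partial>distr ?N borel (B k))"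
    by (simp add: integral_distr integral_density)
  also have "\<dots> = p * (\<integral>b. \<phi> b \<partial>\<rho>)"
    unfolding law using p by (simp add: integral_density)
  finally have win_eq: "(\<integral>\<omega>. ?win \<omega> * \<phi> (B k \<omega>) \<partial>M) = p * (\<integral>b. \<phi> b \<partial>\<rho>)" .
  have loss: "integrable M (\<lambda>\<omega>. c * indicator {\<omega> \<in> space M. \<not> W k \<omega>} \<omega>)"
    by (intro integrable_mult_right integrable_real_indicator) (simp_all add: less_top[symmetric])
  have loss_eq: "(\<integral>\<omega>. c * indicator {\<omega> \<in> space M. \<not> W k \<omega>} \<omega> \<partial>M) = (1 - p) * c"
    using prob_loss[OF \<rho>, of k] by simp
  have split: "(if W k \<omega> then \<phi> (B k \<omega>) else c)
      = ?win \<omega> * \<phi> (B k \<omega>) + c * indicator {\<omega> \<in> space M. \<not> W k \<omega>} \<omega>"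
    if "\<omega> \<in> space M" for \<omega>
    using that by (auto simp: indicator_def)
  show "integrable M (\<lambda>\<omega>. if W k \<omega> then \<phi> (B k \<omega>) else c)"
    using Bochner_Integration.integrable_add[OF win loss]
    by (subst Bochner_Integration.integrable_cong[OF refl split]) auto
  have "expectation (\<lambda>\<omega>. if W k \<omega> then \<phi> (B k \<omega>) else c)
      = (\<integral>\<omega>. ?win \<omega> * \<phi> (B k \<omega>) + c * indicator {\<omega> \<in> space M. \<not> W k \<omega>} \<omega> \<partial>M)"
    by (rule Bochner_Integration.integral_cong[OF refl split])
  then show "expectation (\<lambda>\<omega>. if W k \<omega> then \<phi> (B k \<omega>) else c) = p * (\<integral>b. \<phi> b \<partial>\<rho>) + (1 - p) * c"
    using Bochner_Integration.integral_add[OF win loss] win_eq loss_eq by simp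
qed

lemma AE_win_payoff_nonneg:
  assumes "real_distribution \<rho>" "AE b in \<rho>. 0 \<le> b"
  shows "AE \<omega> in M. \<forall>k. W k \<omega> \<longrightarrow> 0 \<le> B k \<omega>"
proof (subst AE_all_countable, intro allI)
  fix k
  interpret \<rho>: real_distribution \<rho> by fact
  have "measure \<rho> {..<0} = 0"
    using assms(2) \<rho>.prob_eq_0[of "{..<0}"] by (auto elim!: eventually_mono)
  then have "prob {\<omega> \<in> space M. W k \<omega> \<and> B k \<omega> \<in> {..<0}} = 0"
    using win_law[of "{..<0}" k] by simp
  then have "AE \<omega> in M. \<omega> \<notin> {\<omega> \<in> space M. W k \<omega> \<and> B k \<omega> \<in> {..<0}}"
    by (subst (asm) prob_eq_0) simp_all
  then show "AE \<omega> in M. W k \<omega> \<longrightarrow> 0 \<le> B k \<omega>"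
    using AE_space by eventually_elim auto
qed

section \<open>Favorability and the expected growth rate\<close>

text \<open>
  The gain is \<open>x0 * f\<close> times the pay-off in a won round and \<open>- x0 * f\<close> in a lost one.  So its
  positive and negative parts have expectations \<open>x0 * f * p * \<integral> b d\<rho>\<close> and \<open>x0 * f * (1 - p)\<close>; the
  second is finite, and the assumption on the mean says that the first is larger.
\<close>

lemma favorable_of_mean:
  assumes \<rho>: "real_distribution \<rho>" "AE b in \<rho>. 0 \<le> b"
    and p: "0 \<le> p" "p \<le> 1" and mean: "ennreal p * (1 + (\<integral>\<^sup>+b. ennreal b \<partial>\<rho>)) > 1"
  shows "favorable M W B"
  unfolding favorable_def
proof (intro allI impI)
  fix x0 f :: real assume x0: "0 < x0" and f: "0 < f \<and> f \<le> 1"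
  define gain where "gain \<omega> = capital W B f x0 1 \<omega> - capital W B f x0 0 \<omega>" for \<omega>
  have gain: "gain \<omega> = (if W 0 \<omega> then x0 * f * B 0 \<omega> else - (x0 * f))" for \<omega>
    by (simp add: gain_def algebra_simps)
  have [measurable]: "gain \<in> borel_measurable M"
    unfolding gain_def[abs_def] by measurable
  have xf: "0 < x0 * f" using x0 f by simp
  let ?P = "\<integral>\<^sup>+\<omega>. e2ennreal (ereal (gain \<omega>)) \<partial>M"
  let ?N = "\<integral>\<^sup>+\<omega>. e2ennreal (- ereal (gain \<omega>)) \<partial>M"
  interpret \<rho>: real_distribution \<rho> by fact
  have "?P = (\<integral>\<^sup>+\<omega>. (if W 0 \<omega> then ennreal (x0 * f * B 0 \<omega>) else 0) \<partial>M)"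
    using xf by (intro nn_integral_cong) (auto simp: gain ennreal_neg)
  also have "\<dots> = ennreal p * (\<integral>\<^sup>+b. ennreal (x0 * f * b) \<partial>\<rho>)"
    by (rule nn_integral_win[OF \<rho>(1) p(1)]) simp
  also have "(\<integral>\<^sup>+b. ennreal (x0 * f * b) \<partial>\<rho>) = (\<integral>\<^sup>+b. ennreal (x0 * f) * ennreal b \<partial>\<rho>)"
    using xf by (intro nn_integral_cong) (auto simp: ennreal_mult')
  also have "\<dots> = ennreal (x0 * f) * (\<integral>\<^sup>+b. ennreal b \<partial>\<rho>)"
    by (simp add: nn_integral_cmult)
  finally have P: "?P = ennreal (x0 * f) * (ennreal p * (\<integral>\<^sup>+b. ennreal b \<partial>\<rho>))"
    by (simp add: ac_simps)
  have "AE \<omega> in M. e2ennreal (- ereal (gain \<omega>))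
      = ennreal (x0 * f) * indicator {\<omega> \<in> space M. \<not> W 0 \<omega>} \<omega>"
    using AE_win_payoff_nonneg[OF \<rho>] AE_space
  proof eventually_elim
    case (elim \<omega>)
    then show ?case using xf by (auto simp: gain ennreal_neg indicator_def)
  qed
  then have "?N = (\<integral>\<^sup>+\<omega>. ennreal (x0 * f) * indicator {\<omega> \<in> space M. \<not> W 0 \<omega>} \<omega> \<partial>M)"
    by (rule nn_integral_cong_AE)
  also have "\<dots> = ennreal (x0 * f) * ennreal (1 - p)"
    using prob_loss[OF \<rho>(1), of 0] by (simp add: nn_integral_cmult_indicator emeasure_eq_measure)
  finally have N: "?N = ennreal (x0 * f) * ennreal (1 - p)" .
  have "ennreal (1 - p) < ennreal p * (\<integral>\<^sup>+b. ennreal b \<partial>\<rho>)"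
  proof (rule ccontr)
    assume "\<not> ?thesis"
    then have "ennreal p + ennreal p * (\<integral>\<^sup>+b. ennreal b \<partial>\<rho>) \<le> ennreal p + ennreal (1 - p)"
      by (intro add_left_mono) simp
    also have "\<dots> = 1" using p by (simp flip: ennreal_plus)
    finally show False using mean by (simp add: distrib_left)
  qed
  then have "?N < ?P"
    unfolding P N using xf by (intro ennreal_mult_strict_left_mono) auto
  have "?N < \<infinity>" unfolding N by (simp add: ennreal_mult_less_top)
  define e where "e = enn2ereal ?P - enn2ereal ?N"
  have "0 < e"
    unfolding e_def using \<open>?N < ?P\<close> \<open>?N < \<infinity>\<close>
    by (cases "?N"; cases "?P") (auto simp: ennreal_less_iff enn2ereal_ennreal)
  moreover have "has_expectation M (\<lambda>\<omega>. ereal (gain \<omega>)) e"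
    unfolding has_expectation_def e_def using \<open>?N < \<infinity>\<close> by simp
  ultimately show "\<exists>e>0. has_expectation M
      (\<lambda>\<omega>. ereal (capital W B f x0 1 \<omega> - capital W B f x0 0 \<omega>)) e"
    unfolding gain_def by blast
qed

text \<open>
  The growth rate agrees almost surely with an average of \<open>n\<close> real random variables, each of which
  has the expectation of a single round.
\<close>

lemma has_expectation_growth_rate_interior:
  assumes \<rho>: "real_distribution \<rho>" "AE b in \<rho>. 0 \<le> b" and p: "0 \<le> p"
    and int: "integrable \<rho> (\<lambda>b. ln (1 + b * f))"
    and x0: "0 < x0" and n: "1 \<le> n" and f: "0 \<le> f" "f < 1"
  shows "has_expectation M (growth_rate W B f x0 n) (expected_growth p \<rho> f)"
proof -
  define Y where "Y k \<omega> = (if W k \<omega> then ln (1 + B k \<omega> * f) else ln (1 - f))" for k \<omega>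
  define m where "m = p * (\<integral>b. ln (1 + b * f) \<partial>\<rho>) + (1 - p) * ln (1 - f)"
  have Y: "integrable M (Y k)" "expectation (Y k) = m" for k
    using expectation_round[OF \<rho>(1) p int, where c = "ln (1 - f)"]
    unfolding Y_def[abs_def] m_def by auto
  have S: "integrable M (\<lambda>\<omega>. (\<Sum>k<n. Y k \<omega>) / real n)"
    using Y(1) by (intro integrable_divide Bochner_Integration.integrable_sum) auto
  have "AE \<omega> in M. growth_rate W B f x0 n \<omega> = ereal ((\<Sum>k<n. Y k \<omega>) / real n)"
    using AE_win_payoff_nonneg[OF \<rho>]
  proof eventually_elim
    case (elim \<omega>)
    then show ?case
      using ln_capital_ratio[of x0 f W \<omega> B n] x0 f
      by (simp add: growth_rate_def elog_def Y_def)
  qed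
  note has_expectation_AE_integrable[OF growth_rate_measurable S this]
  moreover have "expectation (\<lambda>\<omega>. (\<Sum>k<n. Y k \<omega>) / real n) = m"
    using Y n by (simp add: Bochner_Integration.integral_sum)
  moreover have "expected_growth p \<rho> f = ereal m"
    using f by (simp add: expected_growth_def elog_def m_def add.commute)
  ultimately show ?thesis by simp
qed

text \<open>
  With positive probability \<open>1 - p\<close> the first round already ruins the player, which makes the
  expectation of the negative part infinite.  Hence the expectation is \<open>-\<infinity>\<close> as soon as the
  positive part is integrable.
\<close>

lemma has_expectation_growth_rate_all_in:
  assumes \<rho>: "real_distribution \<rho>" "AE b in \<rho>. 0 \<le> b" and p: "0 \<le> p" "p < 1"
    and int: "integrable \<rho> (\<lambda>b. ln (1 + b))"
    and x0: "0 < x0" and n: "1 \<le> n"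
  shows "has_expectation M (growth_rate W B 1 x0 n) (expected_growth p \<rho> 1)"
proof -
  let ?G = "growth_rate W B 1 x0 n"
  define Z where "Z k \<omega> = (if W k \<omega> then ln (1 + B k \<omega>) else 0)" for k \<omega>
  have "integrable M (Z k)" for k
    using expectation_round(1)[OF \<rho>(1) p(1) int, where c = 0] unfolding Z_def[abs_def] .
  then have S: "integrable M (\<lambda>\<omega>. (\<Sum>k<n. Z k \<omega>) / real n)"
    by (intro integrable_divide Bochner_Integration.integrable_sum) auto
  have "(\<integral>\<^sup>+\<omega>. e2ennreal (?G \<omega>) \<partial>M) \<le> (\<integral>\<^sup>+\<omega>. ennreal ((\<Sum>k<n. Z k \<omega>) / real n) \<partial>M)"
  proof (rule nn_integral_mono_AE)
    show "AE \<omega> in M. e2ennreal (?G \<omega>) \<le> ennreal ((\<Sum>k<n. Z k \<omega>) / real n)"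
      using AE_win_payoff_nonneg[OF \<rho>]
    proof eventually_elim
      case (elim \<omega>)
      then have "elog (capital W B 1 x0 n \<omega> / x0) \<le> ereal (\<Sum>k<n. Z k \<omega>)"
        using all_in_capital_le[of x0 W \<omega> B n] x0 unfolding Z_def by (intro elog_le_of_le_exp) auto
      then have "?G \<omega> \<le> ereal (1 / real n) * ereal (\<Sum>k<n. Z k \<omega>)"
        unfolding growth_rate_def capital.simps(1) by (intro ereal_mult_left_mono) auto
      then have "?G \<omega> \<le> ereal ((\<Sum>k<n. Z k \<omega>) / real n)" by simp
      from e2ennreal_mono[OF this] show ?case by simp
    qed
  qed
  also have "\<dots> < \<infinity>"
    using integrableD(2)[OF S] by (simp add: less_top real_integrable_def)
  finally have pos: "(\<integral>\<^sup>+\<omega>. e2ennreal (?G \<omega>) \<partial>M) < \<infinity>" .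
  have "\<infinity> = (\<integral>\<^sup>+\<omega>. \<infinity> * indicator {\<omega> \<in> space M. \<not> W 0 \<omega>} \<omega> \<partial>M)"
    using prob_loss[OF \<rho>(1), of 0] p
    by (subst nn_integral_cmult_indicator) (simp_all add: emeasure_eq_measure ennreal_top_mult)
  also have "\<dots> \<le> (\<integral>\<^sup>+\<omega>. e2ennreal (- ?G \<omega>) \<partial>M)"
    using n by (intro nn_integral_mono)
      (auto simp: indicator_def growth_rate_def all_in_capital_lost elog_def)
  finally have neg: "(\<integral>\<^sup>+\<omega>. e2ennreal (- ?G \<omega>) \<partial>M) = \<infinity>" by (simp add: top_unique)
  have "expected_growth p \<rho> 1 = - \<infinity>"
    using p by (simp add: expected_growth_def elog_def)
  moreover have "enn2ereal (\<integral>\<^sup>+\<omega>. e2ennreal (?G \<omega>) \<partial>M) - enn2ereal \<infinity> = - \<infinity>"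
    using pos by (cases "\<integral>\<^sup>+\<omega>. e2ennreal (?G \<omega>) \<partial>M") (auto simp: enn2ereal_ennreal)
  ultimately show ?thesis
    unfolding has_expectation_def neg using pos by simp
qed

end

section \<open>Integrals against the pay-off distribution\<close>

text \<open>
  The second bound is uniform in the pay-off.  It is why the derivative of the expected growth is
  finite at every positive fraction, even if the mean pay-off is infinite.
\<close>

lemma payoff_ratio_bound:
  fixes b f :: real
  assumes "0 \<le> b" "0 < f"
  shows "0 \<le> b / (1 + b * f)" "b / (1 + b * f) \<le> 1 / f"
proof -
  have "0 < 1 + b * f" using assms by (simp add: add_pos_nonneg)
  then show "0 \<le> b / (1 + b * f)" "b / (1 + b * f) \<le> 1 / f"
    using assms by (simp_all add: field_simps)
qed

context real_distribution
begin

text \<open>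
  The finiteness assumption stops short of \<open>f = 1\<close>, but \<open>1 + b \<le> 2 (1 + b / 2)\<close> reduces that
  endpoint to \<open>f = 1/2\<close>.
\<close>

lemma integrable_ln_payoff:
  assumes nonneg: "AE b in M. 0 \<le> b"
    and fin: "\<And>f. 0 \<le> f \<Longrightarrow> f < 1 \<Longrightarrow> (\<integral>\<^sup>+b. ennreal (ln (1 + b * f)) \<partial>M) < \<infinity>"
    and f: "0 \<le> f" "f \<le> 1"
  shows "integrable M (\<lambda>b. ln (1 + b * f))"
proof -
  have interior: "integrable M (\<lambda>b. ln (1 + b * f))" if "0 \<le> f" "f < 1" for f
    using nonneg that fin[OF that] by (intro integrableI_nonneg) (auto elim!: eventually_mono)
  show ?thesis
  proof (cases "f = 1")
    case False
    then show ?thesis using interior f by simp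
  next
    case True
    have "integrable M (\<lambda>b. ln 2 + ln (1 + b * (1/2)))"
      using interior[of "1/2"] by simp
    then have "integrable M (\<lambda>b. ln (1 + b))"
    proof (rule Bochner_Integration.integrable_bound)
      show "AE b in M. norm (ln (1 + b)) \<le> norm (ln 2 + ln (1 + b * (1/2)))"
        using nonneg
      proof eventually_elim
        case (elim b)
        have "ln (1 + b) \<le> ln (2 * (1 + b * (1/2)))"
          using elim by (subst ln_le_cancel_iff) auto
        also have "\<dots> = ln 2 + ln (1 + b * (1/2))"
          using elim by (intro ln_mult_pos) simp_all
        finally show ?case using elim by simp
      qed
    qed simp
    then show ?thesis using True by simp
  qed
qed

lemma integrable_payoff_ratio:
  assumes nonneg: "AE b in M. 0 \<le> b" and f: "0 < f"
  shows "integrable M (\<lambda>b. b / (1 + b * f))"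
  using nonneg f
  by (intro integrable_const_bound[where B = "1 / f"])
     (auto elim!: eventually_mono simp: payoff_ratio_bound abs_of_nonneg)

lemma continuous_on_expectation_payoff_ratio:
  assumes nonneg: "AE b in M. 0 \<le> b" and a: "0 < a"
  shows "continuous_on {a..c} (\<lambda>f. \<integral>b. b / (1 + b * f) \<partial>M)"
  unfolding continuous_on_sequentially comp_def
proof (intro allI ballI impI, elim conjE)
  fix x :: "nat \<Rightarrow> real" and f
  assume f: "f \<in> {a..c}" and x: "\<forall>n. x n \<in> {a..c}" "x \<longlonglongrightarrow> f"
  show "(\<lambda>n. \<integral>b. b / (1 + b * x n) \<partial>M) \<longlonglongrightarrow> (\<integral>b. b / (1 + b * f) \<partial>M)"
  proof (rule integral_dominated_convergence[where w = "\<lambda>_. 1 / a"])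
    show "AE b in M. (\<lambda>n. b / (1 + b * x n)) \<longlonglongrightarrow> b / (1 + b * f)"
      using nonneg
    proof eventually_elim
      case (elim b)
      then have "0 < 1 + b * f" using f a by (intro add_pos_nonneg) auto
      then show ?case using x(2) by (intro tendsto_intros) auto
    qed
    show "AE b in M. norm (b / (1 + b * x n)) \<le> 1 / a" for n
      using nonneg
    proof eventually_elim
      case (elim b)
      have xn: "a \<le> x n" using x(1) by simp
      then have "1 / x n \<le> 1 / a" using a by (intro divide_left_mono) auto
      then show ?case using payoff_ratio_bound[of b "x n"] elim xn a by simp
    qed
  qed simp_all
qed

text \<open>
  Near the fraction \<open>0\<close> the uniform bound degenerates and the limit integral may be infinite, so
  dominated convergence is replaced by Fatou's lemma, which gives the lower bound that is needed.
\<close>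

lemma eventually_expectation_payoff_ratio_gt:
  assumes nonneg: "AE b in M. 0 \<le> b" and x: "x \<longlonglongrightarrow> 0" "\<And>n. 0 < x n"
    and c: "0 \<le> c" "ennreal c < (\<integral>\<^sup>+b. ennreal b \<partial>M)"
  shows "\<forall>\<^sub>F n in sequentially. c < (\<integral>b. b / (1 + b * x n) \<partial>M)"
proof -
  have "(\<integral>\<^sup>+b. ennreal b \<partial>M) = (\<integral>\<^sup>+b. liminf (\<lambda>n. ennreal (b / (1 + b * x n))) \<partial>M)"
  proof (rule nn_integral_cong)
    fix b :: real
    have "(\<lambda>n. b / (1 + b * x n)) \<longlonglongrightarrow> b / (1 + b * 0)"
      using x(1) by (intro tendsto_intros) auto
    then have "(\<lambda>n. ennreal (b / (1 + b * x n))) \<longlonglongrightarrow> ennreal b"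
      by (intro tendsto_ennrealI) simp
    then show "ennreal b = liminf (\<lambda>n. ennreal (b / (1 + b * x n)))"
      by (intro lim_imp_Liminf[symmetric]) auto
  qed
  also have "\<dots> \<le> liminf (\<lambda>n. \<integral>\<^sup>+b. ennreal (b / (1 + b * x n)) \<partial>M)"
    by (rule nn_integral_liminf) simp
  finally have "\<forall>\<^sub>F n in sequentially. ennreal c < (\<integral>\<^sup>+b. ennreal (b / (1 + b * x n)) \<partial>M)"
    using c(2) by (intro less_LiminfD) (rule less_le_trans)
  then show ?thesis
  proof eventually_elim
    case (elim n)
    have "(\<integral>\<^sup>+b. ennreal (b / (1 + b * x n)) \<partial>M) = ennreal (\<integral>b. b / (1 + b * x n) \<partial>M)"
      using nonneg x(2)[of n]
      by (intro nn_integral_eq_integral integrable_payoff_ratio)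
         (auto elim!: eventually_mono simp: payoff_ratio_bound)
    then show ?case using elim c(1) by (simp add: ennreal_less_iff)
  qed
qed

section \<open>The optimal fraction\<close>

text \<open>
  The win probability \<open>p\<close> is itself an upper bracket for the intermediate value theorem: the
  expectation of \<open>b / (1 + b p)\<close> is at most \<open>1 / p\<close>, so the left-hand side of the equation is
  at most \<open>1 - 1 = 0\<close> there, whatever the distribution.  The lower bracket comes from fractions
  tending to \<open>0\<close>.
\<close>

lemma ex_stationary_fraction:
  assumes p: "0 < p" "p < 1" and nonneg: "AE b in M. 0 \<le> b"
    and mean: "ennreal p * (1 + (\<integral>\<^sup>+b. ennreal b \<partial>M)) > 1"
  obtains f where "0 < f" "f < 1" "p * (\<integral>b. b / (1 + b * f) \<partial>M) - (1 - p) / (1 - f) = 0"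
proof -
  define h where "h f = p * (\<integral>b. b / (1 + b * f) \<partial>M) - (1 - p) / (1 - f)" for f
  have "ennreal ((1 - p) / p) < (\<integral>\<^sup>+b. ennreal b \<partial>M)"
  proof (rule ccontr)
    assume "\<not> ?thesis"
    then have "ennreal p * (1 + (\<integral>\<^sup>+b. ennreal b \<partial>M)) \<le> ennreal p * (1 + ennreal ((1 - p) / p))"
      by (intro mult_left_mono add_left_mono) auto
    also have "\<dots> = ennreal (p * (1 + (1 - p) / p))"
      using p by (simp add: ennreal_mult)
    also have "p * (1 + (1 - p) / p) = 1" using p by (simp add: field_simps)
    finally show False using mean by simp
  qed
  \<comment> \<open>The gap up to a real \<open>c\<close> eventually absorbs the factor \<open>1 / (1 - x n)\<close>, which tends to
    \<open>1\<close> from above.\<close>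
  then obtain c' where c': "ennreal ((1 - p) / p) < c'" "c' < (\<integral>\<^sup>+b. ennreal b \<partial>M)"
    using dense by blast
  then obtain c where c: "0 \<le> c" "(1 - p) / p < c" "ennreal c < (\<integral>\<^sup>+b. ennreal b \<partial>M)"
    using p by (cases c') (auto simp: ennreal_less_iff)
  define x where "x n = inverse (real (Suc n))" for n
  have x: "x \<longlonglongrightarrow> 0" "\<And>n. 0 < x n"
    unfolding x_def by (rule LIMSEQ_inverse_real_of_nat) simp
  have "(\<lambda>n. (1 - p) / (1 - x n)) \<longlonglongrightarrow> (1 - p) / (1 - 0)"
    using x(1) by (intro tendsto_intros) auto
  moreover have "1 - p < p * c" using c(2) p by (simp add: field_simps)
  ultimately have "\<forall>\<^sub>F n in sequentially. (1 - p) / (1 - x n) < p * c"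
    by (intro order_tendstoD) auto
  moreover have "\<forall>\<^sub>F n in sequentially. x n < p"
    using x(1) p(1) by (rule order_tendstoD)
  moreover have "\<forall>\<^sub>F n in sequentially. c < (\<integral>b. b / (1 + b * x n) \<partial>M)"
    by (rule eventually_expectation_payoff_ratio_gt[OF nonneg x c(1,3)])
  ultimately have "\<forall>\<^sub>F n in sequentially. x n < p \<and> 0 \<le> h (x n)"
  proof eventually_elim
    case (elim n)
    have "p * c \<le> p * (\<integral>b. b / (1 + b * x n) \<partial>M)" using elim p by (intro mult_left_mono) auto
    then show ?case using elim unfolding h_def by linarith
  qed
  then obtain n where n: "x n < p" "0 \<le> h (x n)"
    using eventually_happens sequentially_bot by blast
  have "(\<integral>b. b / (1 + b * p) \<partial>M) \<le> (\<integral>b. 1 / p \<partial>M)"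
    using nonneg p
    by (intro integral_mono_AE integrable_payoff_ratio)
       (auto elim!: eventually_mono simp: payoff_ratio_bound)
  then have "h p \<le> 0"
    using p prob_space unfolding h_def by (simp add: field_simps)
  moreover have "continuous_on {x n..p} h"
    unfolding h_def using p x(2)[of n]
    by (intro continuous_intros continuous_on_expectation_payoff_ratio nonneg) auto
  ultimately obtain f where "x n \<le> f" "f \<le> p" "h f = 0"
    using IVT2'[of h p 0 "x n"] n by auto
  then show ?thesis
    using that[of f] p x(2)[of n] unfolding h_def by simp
qed

text \<open>
  Concavity in its integrated form: the tangent line inequality for the logarithm holds for each
  pay-off, and the expectations of the tangent slopes cancel at a stationary fraction.  At \<open>f = 1\<close>
  the value is \<open>-\<infinity>\<close>.
\<close>

lemma expected_growth_le_stationary: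
  assumes p: "0 < p" "p < 1" and nonneg: "AE b in M. 0 \<le> b"
    and int: "\<And>f. 0 \<le> f \<Longrightarrow> f < 1 \<Longrightarrow> integrable M (\<lambda>b. ln (1 + b * f))"
    and s: "0 < s" "s < 1" "p * (\<integral>b. b / (1 + b * s) \<partial>M) - (1 - p) / (1 - s) = 0"
    and f: "0 \<le> f" "f \<le> 1"
  shows "expected_growth p M f \<le> expected_growth p M s"
proof (cases "f = 1")
  case True
  then show ?thesis using p by (simp add: expected_growth_def elog_def)
next
  case False
  then have f1: "f < 1" using f by simp
  have "(\<integral>b. ln (1 + b * f) \<partial>M) - (\<integral>b. ln (1 + b * s) \<partial>M)
      = (\<integral>b. ln (1 + b * f) - ln (1 + b * s) \<partial>M)"
    using int f f1 s by (intro Bochner_Integration.integral_diff[symmetric]) auto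
  also have "\<dots> \<le> (\<integral>b. (f - s) * (b / (1 + b * s)) \<partial>M)"
  proof (rule integral_mono_AE)
    show "AE b in M. ln (1 + b * f) - ln (1 + b * s) \<le> (f - s) * (b / (1 + b * s))"
      using nonneg
    proof eventually_elim
      case (elim b)
      then have "0 < 1 + b * f" "0 < 1 + b * s" using f s by (simp_all add: add_pos_nonneg)
      from ln_diff_le[OF this] show ?case by (simp add: algebra_simps)
    qed
    show "integrable M (\<lambda>b. (f - s) * (b / (1 + b * s)))"
      using integrable_payoff_ratio[OF nonneg s(1)] by (rule integrable_mult_right)
  qed (use int f f1 s in auto)
  also have "\<dots> = (f - s) * (\<integral>b. b / (1 + b * s) \<partial>M)"
    by (rule integral_mult_right_zero)
  finally have "p * ((\<integral>b. ln (1 + b * f) \<partial>M) - (\<integral>b. ln (1 + b * s) \<partial>M))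
      \<le> p * ((f - s) * (\<integral>b. b / (1 + b * s) \<partial>M))"
    using p by (intro mult_left_mono) auto
  also have "\<dots> = (f - s) * (p * (\<integral>b. b / (1 + b * s) \<partial>M))" by simp
  also have "p * (\<integral>b. b / (1 + b * s) \<partial>M) = (1 - p) / (1 - s)" using s(3) by simp
  finally have win: "p * ((\<integral>b. ln (1 + b * f) \<partial>M) - (\<integral>b. ln (1 + b * s) \<partial>M))
      \<le> (f - s) * ((1 - p) / (1 - s))" .
  have "(1 - p) * (ln (1 - f) - ln (1 - s)) \<le> (1 - p) * (((1 - f) - (1 - s)) / (1 - s))"
    using ln_diff_le[of "1 - f" "1 - s"] f1 s p by (intro mult_left_mono) auto
  also have "\<dots> = - ((f - s) * ((1 - p) / (1 - s)))"
    using s by (simp add: field_simps)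
  finally have loss: "(1 - p) * (ln (1 - f) - ln (1 - s)) \<le> - ((f - s) * ((1 - p) / (1 - s)))" .
  from win loss have "(1 - p) * ln (1 - f) + p * (\<integral>b. ln (1 + b * f) \<partial>M)
      \<le> (1 - p) * ln (1 - s) + p * (\<integral>b. ln (1 + b * s) \<partial>M)"
    by (simp only: right_diff_distrib)
  then show ?thesis using f1 s by (simp add: expected_growth_def elog_def)
qed

end

theorem theorem3p1:
  fixes M :: "'a measure" and p :: real and \<rho> :: "real measure"
    and W :: "nat \<Rightarrow> 'a \<Rightarrow> bool" and B :: "nat \<Rightarrow> 'a \<Rightarrow> real"
  assumes "0 < p" and "p < 1"
    and "real_distribution \<rho>" and "AE b in \<rho>. 0 \<le> b"
    and "\<And>f. 0 \<le> f \<Longrightarrow> f < 1 \<Longrightarrow> (\<integral>\<^sup>+b. ennreal (ln (1 + b * f)) \<partial>\<rho>) < \<infinity>"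
    and "betting_game M p \<rho> W B"
    and "ennreal p * (1 + (\<integral>\<^sup>+b. ennreal b \<partial>\<rho>)) > 1"
  shows "favorable M W B \<and>
    (\<forall>x0>0. \<forall>n\<ge>1. \<forall>f\<in>{0..1}.
       has_expectation M (growth_rate W B f x0 n) (expected_growth p \<rho> f)) \<and>
    (\<exists>fhat. 0 < fhat \<and> fhat < 1 \<and>
       (\<forall>f\<in>{0..1}. expected_growth p \<rho> f \<le> expected_growth p \<rho> fhat) \<and>
       p * (\<integral>b. b / (1 + b * fhat) \<partial>\<rho>) - (1 - p) / (1 - fhat) = 0)"
proof -
  interpret game: betting_game M p \<rho> W B by fact
  interpret \<rho>: real_distribution \<rho> by fact
  have int: "integrable \<rho> (\<lambda>b. ln (1 + b * f))" if "0 \<le> f" "f \<le> 1" for f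
    by (rule \<rho>.integrable_ln_payoff) (fact assms that)+
  have "favorable M W B"
    using assms by (intro game.favorable_of_mean) simp_all
  moreover have "has_expectation M (growth_rate W B f x0 n) (expected_growth p \<rho> f)"
    if "0 < x0" "1 \<le> n" "f \<in> {0..1}" for x0 n f
  proof (cases "f = 1")
    case True
    then show ?thesis
      using game.has_expectation_growth_rate_all_in[of x0 n] int[of 1] that assms by simp
  next
    case False
    then show ?thesis
      using game.has_expectation_growth_rate_interior[of f x0 n] int[of f] that assms by simp
  qed
  moreover obtain s where s: "0 < s" "s < 1"
      "p * (\<integral>b. b / (1 + b * s) \<partial>\<rho>) - (1 - p) / (1 - s) = 0"
    using \<rho>.ex_stationary_fraction[OF assms(1,2,4,7)] .
  moreover have "expected_growth p \<rho> f \<le> expected_growth p \<rho> s" if "f \<in> {0..1}" for f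
    using that int by (intro \<rho>.expected_growth_le_stationary[OF assms(1,2,4) _ s]) auto
  ultimately show ?thesis by blast
qed

end
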